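(* Let $x_1,x_2$ be arbitrary numbers, let $(a_n)$ and $(b_n)$ be arbitrary sequences of numbers, and let $x_n=a_nx_{n-1}+b_nx_{n-2}$ for $n\geqslant 3$. Then for every $n\geqslant 3$, $$ x_n=\sum_{j=1}^{f_n}\bigl((x_1-x_2)(\mathtt{f})_j+x_2\bigr)\Biggl(\prod_{\substack{3\leqslant k\leqslant n\\ (\mathtt{f}_k)_j=1}}b_k\Biggr)\Biggl(\prod_{\substack{3\leqslant k\leqslant n\\ (\mathtt{f}_k)_j+(\mathtt{f}_{k+1})_j=0}}a_k\Biggr), $$ where $f_n$ is the $n$th Fibonacci number, $\mathtt{f}=(0,1,0,0,\ldots)$ is the infinite Fibonacci word, and, for $k\geqslant 3$, $\mathtt{f}_k$ is the infinite $0,1$-sequence obtained from $\mathtt{f}$ by replacing each entry $0$ of $\mathtt{f}$ with a block of $f_{k-1}$ zeros and each entry $1$ of $\mathtt{f}$ with a block of $f_{k-2}$ ones.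
   Context: "Number" means complex number. Fibonacci numbers: $f_1=f_2=1$, $f_n=f_{n-1}+f_{n-2}$ for $n\ge 3$. The infinite Fibonacci word $\mathtt{f}=(0,1,0,0,1,0,1,0,\ldots)$ is the infinite $0,1$-sequence starting with $0$ that is fixed by the substitution $0\mapsto 01$, $1\mapsto 0$. For a vector (finite or infinite sequence) $\mathtt{b}$, $(\mathtt{b})_j$ denotes its $j$th element, with indices starting at $1$. Empty products equal $1$. *)

theory Defs
  imports Complex_Main "HOL-Library.Stream" "HOL-Number_Theory.Fib"
begin

text \<open>
  Infinite 0,1-sequences are modelled as streams of natural numbers, and the numbers \<open>f\<^sub>n\<close> by
  the library function \<^const>\<open>fib\<close> (\<open>fib 1 = fib 2 = 1\<close>).  Streams are indexed from 0, whereas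
  the entries \<open>(b)\<^sub>j\<close> below are indexed from 1.
\<close>

definition entry :: "'a stream \<Rightarrow> nat \<Rightarrow> 'a" where
  "entry s j = s !! (j - 1)"

text \<open>
  Replace each letter of an infinite sequence by a block and concatenate the blocks.  As
  \<^const>\<open>flat\<close> is only meaningful for non-empty blocks, so is this operation.
\<close>

definition substitute :: "('a \<Rightarrow> 'b list) \<Rightarrow> 'a stream \<Rightarrow> 'b stream" where
  "substitute \<sigma> s = flat (smap \<sigma> s)"

text \<open>The substitution \<open>0 \<mapsto> 01\<close>, \<open>1 \<mapsto> 0\<close>; the only letters it is applied to are 0 and 1.\<close>

definition fib_subst :: "nat \<Rightarrow> nat list" where
  "fib_subst c = (if c = 0 then [0, 1] else [0])"

definition is_fib_word :: "nat stream \<Rightarrow> bool" where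
  "is_fib_word s \<longleftrightarrow> sset s \<subseteq> {0, 1} \<and> shd s = 0 \<and> substitute fib_subst s = s"

definition fib_word :: "nat stream" where
  "fib_word = (THE s. is_fib_word s)"

text \<open>
  For \<open>k \<ge> 3\<close>: each 0 of the Fibonacci word becomes \<open>f\<^bsub>k-1\<^esub>\<close> zeros, each 1 becomes
  \<open>f\<^bsub>k-2\<^esub>\<close> ones.  Both blocks are non-empty exactly because \<open>k \<ge> 3\<close>.
\<close>

definition fib_block_word :: "nat \<Rightarrow> nat stream" where
  "fib_block_word k =
     substitute (\<lambda>c. if c = 0 then replicate (fib (k - 1)) 0 else replicate (fib (k - 2)) 1) fib_word"

text \<open>The Fibonacci word exists and is unique, so the definite description above is meaningful.\<close>

lemma substitute_shift:
  assumes "\<And>c. \<sigma> c \<noteq> []"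
  shows "substitute \<sigma> (w @- s) = concat (map \<sigma> w) @- substitute \<sigma> s"
  using assms by (induction w) (auto simp: substitute_def)

lemma fib_subst_nonempty: "fib_subst c \<noteq> []"
  by (simp add: fib_subst_def)

fun fib_prefix :: "nat \<Rightarrow> nat list" where
  "fib_prefix 0 = [0]"
| "fib_prefix (Suc n) = concat (map fib_subst (fib_prefix n))"

lemma fib_prefix_extends: "\<exists>v. v \<noteq> [] \<and> fib_prefix (Suc n) = fib_prefix n @ v"
proof (induction n)
  case 0
  show ?case by (simp add: fib_subst_def)
next
  case (Suc n)
  then obtain v where "v \<noteq> []" "fib_prefix (Suc n) = fib_prefix n @ v" by blast
  have "concat (map fib_subst v) \<noteq> []"
    using \<open>v \<noteq> []\<close> by (cases v) (auto simp: fib_subst_nonempty)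
  moreover have "fib_prefix (Suc (Suc n)) = concat (map fib_subst (fib_prefix n @ v))"
    using \<open>fib_prefix (Suc n) = fib_prefix n @ v\<close> by (metis fib_prefix.simps(2))
  then have "fib_prefix (Suc (Suc n)) = fib_prefix (Suc n) @ concat (map fib_subst v)"
    by simp
  ultimately show ?case by blast
qed

lemma length_fib_prefix: "n < length (fib_prefix n)"
proof (induction n)
  case (Suc n)
  obtain v where "v \<noteq> []" "fib_prefix (Suc n) = fib_prefix n @ v"
    using fib_prefix_extends by blast
  then have "length (fib_prefix n) < length (fib_prefix (Suc n))"
    by (simp del: fib_prefix.simps)
  with Suc show ?case by linarith
qed simp

lemma fib_prefix_mono: "m \<le> n \<Longrightarrow> \<exists>v. fib_prefix n = fib_prefix m @ v"
proof (induction n rule: dec_induct)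
  case (step n)
  then obtain v w where "fib_prefix n = fib_prefix m @ v" "fib_prefix (Suc n) = fib_prefix n @ w"
    using fib_prefix_extends[of n] by blast
  then have "fib_prefix (Suc n) = fib_prefix m @ (v @ w)" by (simp del: fib_prefix.simps)
  then show ?case by blast
qed simp

lemma fib_prefix_nth:
  assumes "i < length (fib_prefix m)" "i < length (fib_prefix n)"
  shows "fib_prefix m ! i = fib_prefix n ! i"
  using assms
proof (induction m n rule: linorder_wlog)
  case (le m n)
  then show ?case using fib_prefix_mono[of m n] by (auto simp: nth_append)
qed simp

lemma stream_eq_if_fib_prefixes:
  assumes "\<And>n. n > 0 \<Longrightarrow> \<exists>u. s = fib_prefix n @- u"
    and "\<And>n. n > 0 \<Longrightarrow> \<exists>u. t = fib_prefix n @- u"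
  shows "s = t"
proof -
  have "s !! i = t !! i" for i
  proof -
    obtain u u' where "s = fib_prefix (Suc i) @- u" "t = fib_prefix (Suc i) @- u'"
      using assms[of "Suc i"] by blast
    moreover have "i < length (fib_prefix (Suc i))"
      using length_fib_prefix[of "Suc i"] by linarith
    ultimately show ?thesis by (simp add: shift_snth_less del: fib_prefix.simps)
  qed
  then show ?thesis
    using smap_alt[of id s t] by (simp add: stream.map_id)
qed

lemma fib_word_prefix:
  assumes "is_fib_word s"
  shows "\<exists>u. s = fib_prefix n @- u"
proof (induction n)
  case 0
  show ?case using assms
    by (metis fib_prefix.simps(1) is_fib_word_def shift.simps stream.collapse)
next
  case (Suc n)
  then show ?case
    using assms substitute_shift[of fib_subst, OF fib_subst_nonempty]
    by (metis fib_prefix.simps(2) is_fib_word_def)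
qed

lemma ex1_fib_word: "\<exists>!s. is_fib_word s"
proof (rule ex_ex1I)
  define s where "s = smap (\<lambda>i. fib_prefix i ! i) nats"
  have snth: "s !! i = fib_prefix i ! i" for i
    by (simp add: s_def)
  have prefix: "\<exists>u. s = fib_prefix n @- u" for n
  proof -
    have "stake (length (fib_prefix n)) s = fib_prefix n"
      by (rule nth_equalityI) (auto simp: snth intro: fib_prefix_nth length_fib_prefix)
    then show ?thesis by (metis stake_sdrop)
  qed
  have "substitute fib_subst s = s"
  proof (rule stream_eq_if_fib_prefixes)
    fix n :: nat assume "n > 0"
    then obtain m where n: "n = Suc m" by (cases n) auto
    obtain u where "s = fib_prefix m @- u" using prefix by blast
    then show "\<exists>u. substitute fib_subst s = fib_prefix n @- u"
      using substitute_shift[of fib_subst, OF fib_subst_nonempty] by (auto simp: n)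
  qed (rule prefix)
  moreover have "set (fib_prefix n) \<subseteq> {0, 1}" for n
    by (induction n) (auto simp: fib_subst_def split: if_splits)
  then have "sset s \<subseteq> {0, 1}"
    unfolding sset_range using nth_mem[OF length_fib_prefix] snth by (metis image_subsetI subsetD)
  moreover have "shd s = 0"
    using snth[of 0] by simp
  ultimately show "\<exists>s. is_fib_word s"
    unfolding is_fib_word_def by blast
next
  fix s t assume "is_fib_word s" "is_fib_word t"
  then show "s = t"
    by (intro stream_eq_if_fib_prefixes fib_word_prefix)
qed

lemma is_fib_word_fib_word: "is_fib_word fib_word"
  unfolding fib_word_def by (rule theI'[OF ex1_fib_word])

end

theory Submission
  imports Defs
begin

text \<open>
  Let \<open>\<phi>\<close> be the substitution \<open>0 \<mapsto> 01\<close>, \<open>1 \<mapsto> 0\<close>.  Applied \<open>m\<close> times to \<open>0\<close> it gives a prefix of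
  the Fibonacci word, and these prefixes satisfy the concatenation recurrence
  \<open>\<phi>\<^sup>m\<^sup>+\<^sup>2(0) = \<phi>\<^sup>m\<^sup>+\<^sup>1(0) \<phi>\<^sup>m(0)\<close>.  A substitution commutes with concatenation, so the prefixes of
  length \<open>f\<^sub>n\<close> of the block words \<open>\<f>\<^sub>k\<close> obey the same recurrence.  Consequently, for \<open>k < n\<close>, the
  entries of \<open>\<f>\<^sub>k\<close> at the positions \<open>f\<^bsub>n-1\<^esub> + 1, \<dots>, f\<^sub>n\<close> repeat its first \<open>f\<^bsub>n-2\<^esub>\<close> entries
  (\<open>fib_block_entry_shift\<close>), whereas \<open>\<f>\<^sub>n\<close> itself consists there of ones, preceded by \<open>f\<^bsub>n-1\<^esub>\<close> zeros
  (\<open>fib_block_entry_eq_0\<close>, \<open>fib_block_entry_eq_1\<close>).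

  The sum over \<open>1 \<le> j \<le> f\<^sub>n\<close> therefore splits into two ranges that reproduce the two terms of
  \<open>x\<^sub>n = a\<^sub>n x\<^bsub>n-1\<^esub> + b\<^sub>n x\<^bsub>n-2\<^esub>\<close>.  For \<open>j \<le> f\<^bsub>n-1\<^esub>\<close> the \<open>j\<close>th entries of \<open>\<f>\<^sub>n\<close> and \<open>\<f>\<^bsub>n+1\<^esub>\<close> both vanish,
  so that the summand for \<open>n\<close> is \<open>a\<^sub>n\<close> times the summand for \<open>n - 1\<close>.  At \<open>f\<^bsub>n-1\<^esub> + j\<close> with \<open>j \<le> f\<^bsub>n-2\<^esub>\<close>
  the entry of \<open>\<f>\<^sub>n\<close> is 1 and that of \<open>\<f>\<^bsub>n-1\<^esub>\<close> is 0: this contributes \<open>b\<^sub>n\<close>, excludes the factors \<open>a\<^sub>n\<close>,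
  \<open>a\<^bsub>n-1\<^esub>\<close> and \<open>b\<^bsub>n-1\<^esub>\<close>, and leaves the summand for \<open>n - 2\<close> at \<open>j\<close>.  The induction starts at
  \<open>n = 2\<close>, where the formula also holds, and \<open>n = 3\<close>.
\<close>

section \<open>Prefixes of the Fibonacci word and of its block words\<close>

lemma fib_prefix_Suc_Suc: "fib_prefix (Suc (Suc m)) = fib_prefix (Suc m) @ fib_prefix m"
proof (induction m)
  case 0
  show ?case by (simp add: fib_subst_def)
next
  case (Suc m)
  have "fib_prefix (Suc (Suc (Suc m)))
      = concat (map fib_subst (fib_prefix (Suc (Suc m))))" by (rule fib_prefix.simps)
  also have "\<dots> = concat (map fib_subst (fib_prefix (Suc m))) @ concat (map fib_subst (fib_prefix m))"
    unfolding Suc.IH by (simp only: map_append concat_append)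
  also have "\<dots> = fib_prefix (Suc (Suc m)) @ fib_prefix (Suc m)"
    by (simp only: fib_prefix.simps)
  finally show ?case .
qed

lemma substitute_fib_word_nth:
  assumes "\<And>c. \<sigma> c \<noteq> []" and "i < length (concat (map \<sigma> (fib_prefix m)))"
  shows "substitute \<sigma> fib_word !! i = concat (map \<sigma> (fib_prefix m)) ! i"
proof -
  obtain u where u: "fib_word = fib_prefix m @- u"
    using fib_word_prefix[OF is_fib_word_fib_word] by blast
  show ?thesis
    by (subst u) (simp only: substitute_shift[OF assms(1)] shift_snth_less[OF assms(2)])
qed

text \<open>
  By the concatenation recurrence, the image of the prefix \<open>\<phi>\<^sup>m\<^sup>+\<^sup>2(0)\<close> ends in a copy of the image
  of \<open>\<phi>\<^sup>m(0)\<close>.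
\<close>

lemma substitute_fib_word_shift:
  assumes "\<And>c. \<sigma> c \<noteq> []" and "i < length (concat (map \<sigma> (fib_prefix m)))"
  shows "substitute \<sigma> fib_word !! (length (concat (map \<sigma> (fib_prefix (Suc m)))) + i)
       = substitute \<sigma> fib_word !! i"
proof -
  let ?w = "\<lambda>m. concat (map \<sigma> (fib_prefix m))"
  have w: "?w (Suc (Suc m)) = ?w (Suc m) @ ?w m"
    unfolding fib_prefix_Suc_Suc by simp
  then have "length (?w (Suc m)) + i < length (?w (Suc (Suc m)))"
    using assms(2) by simp
  from substitute_fib_word_nth[OF assms(1) this]
  have "substitute \<sigma> fib_word !! (length (?w (Suc m)) + i) = ?w m ! i"
    unfolding w nth_append_length_plus .
  then show ?thesis
    using substitute_fib_word_nth[OF assms] by simp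
qed

abbreviation fib_block :: "nat \<Rightarrow> nat \<Rightarrow> nat list" where
  "fib_block k \<equiv> \<lambda>c. if c = 0 then replicate (fib (k - 1)) 0 else replicate (fib (k - 2)) 1"

lemma fib_block_nonempty: "k \<ge> 3 \<Longrightarrow> fib_block k c \<noteq> []"
  by (simp add: fib_neq_0_nat)

lemma length_fib_block_prefix:
  assumes "k \<ge> 2"
  shows "length (concat (map (fib_block k) (fib_prefix m))) = fib (m + k - 1)"
proof -
  obtain i where k: "k = Suc (Suc i)"
    using assms by (metis add_2_eq_Suc le_Suc_ex)
  show ?thesis
  proof (induction m rule: fib.induct)
    case 1
    show ?case by (simp add: k)
  next
    case 2
    show ?case by (simp add: k fib_subst_def)
  next
    case (3 m)
    show ?case
      unfolding fib_prefix_Suc_Suc map_append concat_append length_append "3.IH"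
      by (simp add: k)
  qed
qed

lemma fib_block_entry_shift:
  assumes "3 \<le> k" "k < n" "1 \<le> j" "j \<le> fib (n - 2)"
  shows "entry (fib_block_word k) (fib (n - 1) + j) = entry (fib_block_word k) j"
proof -
  define m where "m = n - k - 1"
  have "m + k - 1 = n - 2" "Suc m + k - 1 = n - 1"
    using assms(1,2) by (auto simp: m_def)
  then have len: "length (concat (map (fib_block k) (fib_prefix m))) = fib (n - 2)"
      "length (concat (map (fib_block k) (fib_prefix (Suc m)))) = fib (n - 1)"
    using assms(1) length_fib_block_prefix[of k] by (simp_all del: fib_prefix.simps)
  have "j - 1 < length (concat (map (fib_block k) (fib_prefix m)))"
    using assms(3,4) len by linarith
  from substitute_fib_word_shift[OF fib_block_nonempty[OF assms(1)] this]
  have "fib_block_word k !! (fib (n - 1) + (j - 1)) = fib_block_word k !! (j - 1)"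
    unfolding len fib_block_word_def .
  then show ?thesis
    using assms(3) by (simp add: entry_def)
qed

lemma fib_block_word_nth:
  assumes "k \<ge> 3" and "i < fib k"
  shows "fib_block_word k !! i = (if i < fib (k - 1) then 0 else 1)"
proof -
  have prefix: "concat (map (fib_block k) (fib_prefix 1))
      = replicate (fib (k - 1)) 0 @ replicate (fib (k - 2)) 1"
    by (simp add: fib_subst_def)
  have len: "length (concat (map (fib_block k) (fib_prefix 1))) = fib k"
    using length_fib_block_prefix[of k 1] assms(1) by simp
  with assms(2) have "i < length (concat (map (fib_block k) (fib_prefix 1)))"
    by simp
  from substitute_fib_word_nth[OF fib_block_nonempty[OF assms(1)] this]
  have "fib_block_word k !! i = (replicate (fib (k - 1)) 0 @ replicate (fib (k - 2)) 1) ! i"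
    unfolding fib_block_word_def prefix .
  moreover have "i < fib (k - 1) + fib (k - 2)"
    using len assms(2) unfolding prefix by simp
  ultimately show ?thesis
    by (simp add: nth_append less_diff_conv2)
qed

lemma fib_eq_sum: "n \<ge> 2 \<Longrightarrow> fib n = fib (n - 1) + fib (n - 2)"
  using fib.simps(3)[of "n - 2"] by (simp add: Suc_diff_Suc numeral_2_eq_2)

lemma fib_block_entry_eq_0:
  assumes "k \<ge> 3" "1 \<le> j" "j \<le> fib (k - 1)"
  shows "entry (fib_block_word k) j = 0"
  using assms fib_block_word_nth[of k "j - 1"] fib_eq_sum[of k]
  by (simp add: entry_def)

lemma fib_block_entry_eq_1:
  assumes "k \<ge> 3" "1 \<le> j" "j \<le> fib (k - 2)"
  shows "entry (fib_block_word k) (fib (k - 1) + j) = 1"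
  using assms fib_block_word_nth[of k "fib (k - 1) + j - 1"] fib_eq_sum[of k]
  by (simp add: entry_def)

text \<open>
  The blocks of \<open>\<f>\<^sub>3\<close> have length \<open>f\<^sub>2 = f\<^sub>1 = 1\<close>.  The factor of the summand that involves the Fibonacci word
  thus falls under the lemmas on block words.
\<close>

lemma fib_block_word_3: "fib_block_word 3 = fib_word"
proof -
  have "fib_block 3 c = [c]" if "c \<in> sset fib_word" for c
    using that is_fib_word_fib_word by (auto simp: is_fib_word_def)
  then have "smap (fib_block 3) fib_word = smap (\<lambda>c. [c]) fib_word"
    by (rule stream.map_cong0)
  then have "fib_block_word 3 = flat (smap (\<lambda>c. [c]) fib_word)"
    unfolding fib_block_word_def substitute_def by (rule arg_cong)
  also have "\<dots> = fib_word"
  proof -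
    have "flat (smap (\<lambda>c. [c]) s) = s" for s :: "nat stream"
      by (coinduction arbitrary: s) auto
    then show ?thesis .
  qed
  finally show ?thesis .
qed

section \<open>The summand and the recurrence\<close>

definition fib_summand ::
  "complex \<Rightarrow> complex \<Rightarrow> (nat \<Rightarrow> complex) \<Rightarrow> (nat \<Rightarrow> complex) \<Rightarrow> nat \<Rightarrow> nat \<Rightarrow> complex" where
  "fib_summand x1 x2 a b n j =
     ((x1 - x2) * of_nat (entry fib_word j) + x2)
     * (\<Prod>k \<in> {k. 3 \<le> k \<and> k \<le> n \<and> entry (fib_block_word k) j = 1}. b k)
     * (\<Prod>k \<in> {k. 3 \<le> k \<and> k \<le> n \<and>
          entry (fib_block_word k) j + entry (fib_block_word (k + 1)) j = 0}. a k)"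

text \<open>
  The position \<open>j\<close> lies in the initial block of zeros of \<open>\<f>\<^sub>n\<close>, and then also in the longer one of
  \<open>\<f>\<^bsub>n+1\<^esub>\<close>.
\<close>

lemma fib_summand_initial:
  assumes "n \<ge> 3" "1 \<le> j" "j \<le> fib (n - 1)"
  shows "fib_summand x1 x2 a b n j = a n * fib_summand x1 x2 a b (n - 1) j"
proof -
  let ?e = "\<lambda>k. entry (fib_block_word k) j"
  have e: "?e n = 0"
    using fib_block_entry_eq_0 assms by blast
  have "fib (n - 1) \<le> fib n"
    by (rule fib_mono) simp
  then have e': "?e (n + 1) = 0"
    using assms by (intro fib_block_entry_eq_0) auto
  have B: "{k. 3 \<le> k \<and> k \<le> n \<and> ?e k = 1} = {k. 3 \<le> k \<and> k \<le> n - 1 \<and> ?e k = 1}"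
    using e by (auto simp: le_less)
  have A: "{k. 3 \<le> k \<and> k \<le> n \<and> ?e k + ?e (k + 1) = 0}
      = insert n {k. 3 \<le> k \<and> k \<le> n - 1 \<and> ?e k + ?e (k + 1) = 0}"
    using e e' assms(1) by (auto simp: le_less)
  have fin: "finite {k. 3 \<le> k \<and> k \<le> n - 1 \<and> ?e k + ?e (k + 1) = 0}"
    by (rule finite_subset[of _ "{..n}"]) auto
  have notin: "n \<notin> {k. 3 \<le> k \<and> k \<le> n - 1 \<and> ?e k + ?e (k + 1) = 0}"
    using assms(1) by auto
  show ?thesis
    unfolding fib_summand_def A B prod.insert[OF fin notin] by (simp only: mult_ac)
qed

text \<open>
  The position lies in the first block of ones of \<open>\<f>\<^sub>n\<close>.  A shift by \<open>f\<^bsub>n-1\<^esub>\<close> does not affect the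
  earlier block words, so the entry of \<open>\<f>\<^bsub>n-1\<^esub>\<close> is that at \<open>j\<close>, which is 0.  This rules out the factor
  \<open>b\<^bsub>n-1\<^esub>\<close>, and the 1 in \<open>\<f>\<^sub>n\<close> rules out \<open>a\<^bsub>n-1\<^esub>\<close>.
\<close>

lemma fib_summand_final:
  assumes "n \<ge> 4" "1 \<le> j" "j \<le> fib (n - 2)"
  shows "fib_summand x1 x2 a b n (fib (n - 1) + j) = b n * fib_summand x1 x2 a b (n - 2) j"
proof -
  let ?e = "\<lambda>k. entry (fib_block_word k) j"
  let ?e' = "\<lambda>k. entry (fib_block_word k) (fib (n - 1) + j)"
  have shift: "?e' k = ?e k" if "3 \<le> k" "k \<le> n - 1" for k
    using that assms by (intro fib_block_entry_shift) auto
  have e: "?e' n = 1"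
    using assms by (intro fib_block_entry_eq_1) auto
  have "?e (n - 1) = 0"
    using assms by (intro fib_block_entry_eq_0) (auto simp: numeral_2_eq_2)
  then have e': "?e' (n - 1) = 0"
    using shift[of "n - 1"] assms(1) by simp
  have B: "{k. 3 \<le> k \<and> k \<le> n \<and> ?e' k = 1}
      = insert n {k. 3 \<le> k \<and> k \<le> n - 2 \<and> ?e k = 1}"
  proof (rule set_eqI)
    fix k
    consider "k < 3" | "3 \<le> k" "k \<le> n - 2" | "k = n - 1" | "k = n" | "n < k"
      by linarith
    then show "k \<in> {k. 3 \<le> k \<and> k \<le> n \<and> ?e' k = 1}
        \<longleftrightarrow> k \<in> insert n {k. 3 \<le> k \<and> k \<le> n - 2 \<and> ?e k = 1}"
    proof cases
      case 2
      then show ?thesis using shift[of k] assms(1) by auto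
    next
      case 3
      then show ?thesis using e' assms(1) by simp
    next
      case 4
      then show ?thesis using e assms(1) by simp
    qed (use assms(1) in auto)
  qed
  have A: "{k. 3 \<le> k \<and> k \<le> n \<and> ?e' k + ?e' (k + 1) = 0}
      = {k. 3 \<le> k \<and> k \<le> n - 2 \<and> ?e k + ?e (k + 1) = 0}"
  proof (rule Collect_cong)
    fix k
    consider "k < 3" | "3 \<le> k" "k \<le> n - 2" | "k = n - 1" | "k = n" | "n < k"
      by linarith
    then show "(3 \<le> k \<and> k \<le> n \<and> ?e' k + ?e' (k + 1) = 0)
        \<longleftrightarrow> (3 \<le> k \<and> k \<le> n - 2 \<and> ?e k + ?e (k + 1) = 0)"
    proof cases
      case 2
      then show ?thesis using shift[of k] shift[of "k + 1"] assms(1) by auto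
    next
      case 3
      then show ?thesis using e assms(1) by simp
    next
      case 4
      then show ?thesis using e assms(1) by auto
    qed auto
  qed
  have f: "entry fib_word (fib (n - 1) + j) = entry fib_word j"
    using shift[of 3] assms(1) by (simp add: fib_block_word_3)
  have fin: "finite {k. 3 \<le> k \<and> k \<le> n - 2 \<and> ?e k = 1}"
    by (rule finite_subset[of _ "{..n}"]) auto
  have notin: "n \<notin> {k. 3 \<le> k \<and> k \<le> n - 2 \<and> ?e k = 1}"
    using assms(1) by auto
  show ?thesis
    unfolding fib_summand_def A B f prod.insert[OF fin notin] by (simp only: mult_ac)
qed

lemma sum_fib_split:
  fixes g :: "nat \<Rightarrow> 'a :: comm_monoid_add"
  assumes "n \<ge> 2"
  shows "(\<Sum>j = 1..fib n. g j)
       = (\<Sum>j = 1..fib (n - 1). g j) + (\<Sum>j = 1..fib (n - 2). g (fib (n - 1) + j))"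
proof -
  have "(\<Sum>j = 1..fib n. g j)
      = (\<Sum>j = 1..fib (n - 1). g j) + (\<Sum>j = fib (n - 1) + 1..fib (n - 1) + fib (n - 2). g j)"
    unfolding fib_eq_sum[OF assms] by (rule sum.ub_add_nat) simp
  also have "(\<Sum>j = fib (n - 1) + 1..fib (n - 1) + fib (n - 2). g j)
      = (\<Sum>j = 1..fib (n - 2). g (fib (n - 1) + j))"
    using sum.shift_bounds_cl_nat_ivl[of g 1 "fib (n - 1)" "fib (n - 2)"]
    by (simp add: add.commute)
  finally show ?thesis .
qed

lemma fib_summand_2: "fib_summand x1 x2 a b 2 1 = x2"
proof -
  have no_index: "{k. 3 \<le> k \<and> k \<le> (2::nat) \<and> P k} = {}" for P
    by auto
  have "entry fib_word 1 = 0"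
    using fib_block_entry_eq_0[of 3 1] by (simp add: fib_block_word_3)
  then show ?thesis
    by (simp add: fib_summand_def no_index)
qed

lemma fib_summand_3_2: "fib_summand x1 x2 a b 3 2 = b 3 * x1"
proof -
  have e: "entry fib_word 2 = 1"
    using fib_block_entry_eq_1[of 3 1] by (simp add: fib_block_word_3 numeral_2_eq_2)
  have "{k. 3 \<le> k \<and> k \<le> 3 \<and> entry (fib_block_word k) 2 = 1} = {3}"
    using e by (auto simp: fib_block_word_3 dest: antisym)
  moreover have "{k. 3 \<le> k \<and> k \<le> 3 \<and>
      entry (fib_block_word k) 2 + entry (fib_block_word (k + 1)) 2 = 0} = {}"
    using e by (auto simp: fib_block_word_3 dest: antisym)
  ultimately show ?thesis
    unfolding fib_summand_def by (simp only: e) simp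
qed

lemma recurrence_eq_sum_fib_summand:
  fixes x a b :: "nat \<Rightarrow> complex"
  assumes rec: "\<And>m. m \<ge> 3 \<Longrightarrow> x m = a m * x (m - 1) + b m * x (m - 2)"
    and "n \<ge> 2"
  shows "x n = (\<Sum>j = 1..fib n. fib_summand (x 1) (x 2) a b n j)"
  using \<open>n \<ge> 2\<close>
proof (induction n rule: less_induct)
  case (less n)
  let ?T = "fib_summand (x 1) (x 2) a b"
  show ?case
  proof (cases "n = 2")
    case True
    then show ?thesis
      using fib_summand_2 by simp
  next
    case False
    with less.prems have n: "n \<ge> 3" by simp
    have "(\<Sum>j = 1..fib (n - 1). ?T n j) = (\<Sum>j = 1..fib (n - 1). a n * ?T (n - 1) j)"
      using n by (intro sum.cong refl fib_summand_initial) auto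
    also have "\<dots> = a n * x (n - 1)"
      using less.IH[of "n - 1"] n by (simp add: sum_distrib_left)
    finally have initial: "(\<Sum>j = 1..fib (n - 1). ?T n j) = a n * x (n - 1)" .
    have final: "(\<Sum>j = 1..fib (n - 2). ?T n (fib (n - 1) + j)) = b n * x (n - 2)"
    proof (cases "n = 3")
      \<comment> \<open>At index 1 the sum equals \<open>x 2\<close> instead of \<open>x 1\<close>, so \<open>n = 3\<close> is computed directly.\<close>
      case True
      then show ?thesis
        using fib_summand_3_2[of "x 1" "x 2" a b] by (simp add: numeral_2_eq_2)
    next
      case False
      then have "(\<Sum>j = 1..fib (n - 2). ?T n (fib (n - 1) + j))
          = (\<Sum>j = 1..fib (n - 2). b n * ?T (n - 2) j)"
        using n by (intro sum.cong refl fib_summand_final) auto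
      also have "\<dots> = b n * x (n - 2)"
        using less.IH[of "n - 2"] n False by (simp add: sum_distrib_left)
      finally show ?thesis .
    qed
    show ?thesis
      using rec[OF n] sum_fib_split[of n "?T n"] initial final n by simp
  qed
qed

theorem theorem2p1:
  fixes x a b :: "nat \<Rightarrow> complex" and n :: nat
  assumes rec: "\<And>m. m \<ge> 3 \<Longrightarrow> x m = a m * x (m - 1) + b m * x (m - 2)"
    and n: "n \<ge> 3"
  shows "x n = (\<Sum>j = 1..fib n.
           ((x 1 - x 2) * of_nat (entry fib_word j) + x 2)
           * (\<Prod>k \<in> {k. 3 \<le> k \<and> k \<le> n \<and> entry (fib_block_word k) j = 1}. b k)
           * (\<Prod>k \<in> {k. 3 \<le> k \<and> k \<le> n \<and>
                entry (fib_block_word k) j + entry (fib_block_word (k + 1)) j = 0}. a k))"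
  using recurrence_eq_sum_fib_summand[of x a b n, OF rec] n
  unfolding fib_summand_def by simp

end
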